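(* Consider the semidiscrete lumped mass (LM) solution matrix $\mathcal{E}(t)$. If the stiffness matrix $\mathcal{S}$ is diagonally dominant, then $\mathcal{E}(t)$ is contractive in the maximum-norm, i.e. $\|\mathcal{E}(t)V\|_\infty\le\|V\|_\infty$ for all $V\in\mathbb{R}^N$ and $t\ge0$. If $\mathcal{E}(t)$ is contractive in the maximum-norm for small $t$ (i.e. for all $t\in(0,t_0)$ for some $t_0>0$), then $\mathcal{S}$ is diagonally dominant.
   Context: Fractional operator. $P(\partial_t)u(t)=\int_0^1\partial_t^\alpha u(t)\,d\nu(\alpha)$, where $\partial_t^\alpha$ is the Caputo derivative $\partial_t^\alpha u(t)=\frac{1}{\Gamma(1-\alpha)}\int_0^t(t-s)^{-\alpha}u'(s)\,ds$. One of two cases is assumed, with characteristic function $P(z)=\int_0^1z^\alpha d\nu(\alpha)$. Case I: $P(z)=\sum_{i=1}^m b_iz^{\alpha_i}$, $m\ge1$, $0<\alpha_m<\dots<\alpha_1<1$, $b_i>0$, $b_1=1$. Case II: $P(z)=\int_0^1z^\alpha\mu(\alpha)\,d\alpha$, with $\mu\ge0$ Hölder continuous on $[0,1]$ and $\mu(0)\mu(1)>0$. Finite elements. $\Omega\subset\mathbb{R}^2$ is a bounded polygonal domain, $\mathcal{T}_h$ a (conforming) triangulation of $\Omega$, $X_h\subset H_0^1(\Omega)$ the space of continuous functions that are linear on each triangle of $\mathcal{T}_h$ and vanish on $\partial\Omega$. $P_1,\dots,P_N$ are the interior nodes and $\phi_1,\dots,\phi_N$ the corresponding nodal basis. The stiffness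 matrix is $\mathcal{S}=(s_{ij})$, $s_{ij}=\int_\Omega\nabla\phi_j\cdot\nabla\phi_i\,dx$. In the LM method the mass matrix is $\mathcal{M}=(m_{ij})$, $m_{ij}=[\phi_j,\phi_i]$, with $[w,\chi]=\sum_{K\in\mathcal{T}_h}\frac13|K|\sum_{l=1}^3(w\chi)(P_l^K)$, where $P_1^K,P_2^K,P_3^K$ are the vertices of $K$ and $|K|$ its area; thus $\mathcal{M}$ is diagonal with positive diagonal. Set $\mathcal{H}=\mathcal{M}^{-1}\mathcal{S}$. $\|V\|_\infty=\max_i|V_i|$. $\mathcal{S}$ is diagonally dominant if $\sum_{j\ne i}|s_{ij}|\le s_{ii}$ for $i=1,\dots,N$. Semidiscrete solution matrix. $\mathcal{E}(t)$ is the matrix such that $U(t)=\mathcal{E}(t)V$ solves $P(\partial_t)U(t)+\mathcal{H}U(t)=0$ for $t>0$, $U(0)=V$. Equivalently, $\mathcal{E}$ is the continuous matrix function on $[0,\infty)$ with Laplace transform $z^{-1}P(z)(P(z)\mathcal{I}+\mathcal{H})^{-1}$, where $\mathcal{I}$ is the identity matrix. *)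

theory Defs
  imports "HOL-Analysis.Analysis"
begin

section \<open>The fractional operator\<close>

text \<open>The Caputo derivative of order \<open>\<alpha>\<close> of a vector-valued function.
  The value at \<open>\<alpha> = 1\<close>, where the formula is not meaningful, is irrelevant below: it is
  a null set for both kinds of admissible measure.\<close>

definition caputo_derivative :: "real \<Rightarrow> (real \<Rightarrow> 'a::euclidean_space) \<Rightarrow> real \<Rightarrow> 'a" where
  "caputo_derivative \<alpha> u t =
     (1 / Gamma (1 - \<alpha>)) *\<^sub>R
       (LINT s:{0<..<t}|lborel. (t - s) powr (- \<alpha>) *\<^sub>R vector_derivative u (at s))"

definition has_caputo_derivative :: "real \<Rightarrow> (real \<Rightarrow> 'a::euclidean_space) \<Rightarrow> real \<Rightarrow> bool" where
  "has_caputo_derivative \<alpha> u t \<longleftrightarrow>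
     set_integrable lborel {0<..<t} (\<lambda>s. (t - s) powr (- \<alpha>) *\<^sub>R vector_derivative u (at s))"

text \<open>The operator \<open>P(\<partial>\<^sub>t)\<close> belonging to the measure \<open>\<nu>\<close> on \<open>[0,1]\<close>.\<close>

definition frac_op :: "real measure \<Rightarrow> (real \<Rightarrow> 'a::euclidean_space) \<Rightarrow> real \<Rightarrow> 'a" where
  "frac_op \<nu> u t = (LINT \<alpha>|\<nu>. caputo_derivative \<alpha> u t)"

definition frac_op_defined :: "real measure \<Rightarrow> (real \<Rightarrow> 'a::euclidean_space) \<Rightarrow> real \<Rightarrow> bool" where
  "frac_op_defined \<nu> u t \<longleftrightarrow>
     (AE \<alpha> in \<nu>. has_caputo_derivative \<alpha> u t) \<and>
     integrable \<nu> (\<lambda>\<alpha>. caputo_derivative \<alpha> u t)"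

text \<open>Point masses \<open>b\<^sub>i\<close> at \<open>\<alpha>\<^sub>i\<close>, so that the characteristic function
  \<open>P(z) = \<integral> z powr \<alpha> d\<nu>(\<alpha>)\<close> is \<open>\<Sum>i. b\<^sub>i * z powr \<alpha>\<^sub>i\<close>: the image under \<open>i \<mapsto> \<alpha>\<^sub>i\<close> of the measure
  on \<open>{1..m}\<close> with weights \<open>b\<^sub>i\<close>.\<close>

definition multi_term_measure :: "real measure \<Rightarrow> bool" where
  "multi_term_measure \<nu> \<longleftrightarrow>
     (\<exists>(m::nat) (\<alpha>::nat \<Rightarrow> real) (b::nat \<Rightarrow> real).
        1 \<le> m \<and> 0 < \<alpha> m \<and> (\<forall>i\<in>{1..<m}. \<alpha> (Suc i) < \<alpha> i) \<and> \<alpha> 1 < 1 \<and>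
        (\<forall>i\<in>{1..m}. 0 < b i) \<and> b 1 = 1 \<and>
        \<nu> = distr (point_measure {1..m} (\<lambda>i. ennreal (b i))) borel \<alpha>)"

definition holder_continuous_on :: "real set \<Rightarrow> (real \<Rightarrow> real) \<Rightarrow> bool" where
  "holder_continuous_on A f \<longleftrightarrow>
     (\<exists>\<gamma> C. 0 < \<gamma> \<and> \<gamma> \<le> 1 \<and> (\<forall>x\<in>A. \<forall>y\<in>A. \<bar>f x - f y\<bar> \<le> C * \<bar>x - y\<bar> powr \<gamma>))"

definition distributed_order_measure :: "real measure \<Rightarrow> bool" where
  "distributed_order_measure \<nu> \<longleftrightarrow>
     (\<exists>\<mu>::real \<Rightarrow> real.
        (\<forall>\<alpha>\<in>{0..1}. 0 \<le> \<mu> \<alpha>) \<and> holder_continuous_on {0..1} \<mu> \<and> 0 < \<mu> 0 * \<mu> 1 \<and>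
        \<nu> = density lborel (\<lambda>\<alpha>. indicator {0..1} \<alpha> * ennreal (\<mu> \<alpha>)))"

text \<open>Solutions of \<open>P(\<partial>\<^sub>t) U + H U = 0\<close> for \<open>t > 0\<close>, \<open>U(0) = V\<close>. The differentiability and
  integrability requirements say that all the integrals defining \<open>P(\<partial>\<^sub>t) U(t)\<close> exist in the
  Lebesgue sense; the library integral would otherwise default to \<open>0\<close>. The derivative of \<open>U\<close> may
  be unbounded at \<open>0\<close>, as it is for the actual solutions.\<close>

definition solves_frac_ivp ::
  "real measure \<Rightarrow> real^'n^'n \<Rightarrow> real^'n \<Rightarrow> (real \<Rightarrow> real^'n) \<Rightarrow> bool" where
  "solves_frac_ivp \<nu> H V U \<longleftrightarrow>
     continuous_on {0..} U \<and> U 0 = V \<and>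
     (\<forall>t>0. U differentiable (at t) \<and>
            set_integrable lborel {0<..<t} (\<lambda>s. vector_derivative U (at s)) \<and>
            frac_op_defined \<nu> U t \<and>
            frac_op \<nu> U t + H *v U t = 0)"

definition solution_matrix ::
  "real measure \<Rightarrow> real^'n^'n \<Rightarrow> (real \<Rightarrow> real^'n^'n) \<Rightarrow> bool" where
  "solution_matrix \<nu> H E \<longleftrightarrow> (\<forall>V. solves_frac_ivp \<nu> H V (\<lambda>t. E t *v V))"


section \<open>Piecewise linear finite elements\<close>

definition polygonal_domain :: "(real^2) set \<Rightarrow> bool" where
  "polygonal_domain \<Omega> \<longleftrightarrow>
     open \<Omega> \<and> connected \<Omega> \<and> \<Omega> \<noteq> {} \<and> bounded \<Omega> \<and>
     (\<exists>A. finite A \<and> (\<forall>(a, b)\<in>A. a \<noteq> b) \<and> frontier \<Omega> = (\<Union>(a, b)\<in>A. closed_segment a b))"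

text \<open>Conformity, i.e. that two triangles meet in a common edge, a common vertex or not at all,
  is part of the library predicate. The last conjunct says that the boundary is resolved by the
  mesh; it is automatic unless \<open>\<Omega>\<close> has slits.\<close>

definition triangulation_of :: "(real^2) set set \<Rightarrow> (real^2) set \<Rightarrow> bool" where
  "triangulation_of \<T> \<Omega> \<longleftrightarrow>
     triangulation \<T> \<and> (\<forall>K\<in>\<T>. 2 simplex K) \<and> \<Union>\<T> = closure \<Omega> \<and>
     (\<exists>\<F>. (\<forall>F\<in>\<F>. \<exists>K\<in>\<T>. F face_of K) \<and> frontier \<Omega> = \<Union>\<F>)"

definition vertices :: "(real^2) set \<Rightarrow> (real^2) set" where
  "vertices K = {x. x extreme_point_of K}"

definition interior_nodes :: "(real^2) set \<Rightarrow> (real^2) set set \<Rightarrow> (real^2) set" where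
  "interior_nodes \<Omega> \<T> = (\<Union>K\<in>\<T>. vertices K) \<inter> \<Omega>"

text \<open>Functions in the finite element space are extended by \<open>0\<close> outside \<open>\<Omega>\<close>; vanishing off the
  open set \<open>\<Omega>\<close> includes the boundary condition.\<close>

definition fe_space :: "(real^2) set \<Rightarrow> (real^2) set set \<Rightarrow> (real^2 \<Rightarrow> real) set" where
  "fe_space \<Omega> \<T> =
     {f. continuous_on (closure \<Omega>) f \<and>
         (\<forall>K\<in>\<T>. \<exists>a b. \<forall>x\<in>K. f x = a \<bullet> x + b) \<and>
         (\<forall>x. x \<notin> \<Omega> \<longrightarrow> f x = 0)}"

definition nodal_basis ::
  "(real^2) set \<Rightarrow> (real^2) set set \<Rightarrow> ('n \<Rightarrow> real^2) \<Rightarrow> ('n \<Rightarrow> real^2 \<Rightarrow> real) \<Rightarrow> bool" where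
  "nodal_basis \<Omega> \<T> P \<phi> \<longleftrightarrow>
     (\<forall>i. \<phi> i \<in> fe_space \<Omega> \<T>) \<and> (\<forall>i j. \<phi> i (P j) = (if i = j then 1 else 0))"

text \<open>For piecewise linear functions this pointwise gradient is defined off the edges of the mesh,
  hence almost everywhere, and is the weak gradient.\<close>

definition grad :: "(real^2 \<Rightarrow> real) \<Rightarrow> real^2 \<Rightarrow> real^2" where
  "grad f x = (\<chi> k. frechet_derivative f (at x) (axis k 1))"

definition stiffness_matrix :: "(real^2) set \<Rightarrow> ('n::finite \<Rightarrow> real^2 \<Rightarrow> real) \<Rightarrow> real^'n^'n" where
  "stiffness_matrix \<Omega> \<phi> = (\<chi> i j. LINT x:\<Omega>|lborel. grad (\<phi> j) x \<bullet> grad (\<phi> i) x)"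

definition lumped_product ::
  "(real^2) set set \<Rightarrow> (real^2 \<Rightarrow> real) \<Rightarrow> (real^2 \<Rightarrow> real) \<Rightarrow> real" where
  "lumped_product \<T> v w = (\<Sum>K\<in>\<T>. 1/3 * measure lborel K * (\<Sum>p\<in>vertices K. v p * w p))"

definition lumped_mass_matrix :: "(real^2) set set \<Rightarrow> ('n::finite \<Rightarrow> real^2 \<Rightarrow> real) \<Rightarrow> real^'n^'n" where
  "lumped_mass_matrix \<T> \<phi> = (\<chi> i j. lumped_product \<T> (\<phi> j) (\<phi> i))"

definition diagonally_dominant :: "real^'n^'n \<Rightarrow> bool" where
  "diagonally_dominant S \<longleftrightarrow> (\<forall>i. (\<Sum>j\<in>UNIV - {i}. \<bar>S $ i $ j\<bar>) \<le> S $ i $ i)"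

text \<open>On \<^typ>\<open>real^'n\<close> the library's \<^const>\<open>infnorm\<close> is the maximum norm,
  see \<open>infnorm_cart\<close>.\<close>

definition max_norm_contractive :: "real^'n^'n \<Rightarrow> bool" where
  "max_norm_contractive A \<longleftrightarrow> (\<forall>V. infnorm (A *v V) \<le> infnorm V)"

end

theory Submission
  imports Defs
begin

text \<open>Both directions follow from a maximum principle. If \<open>u\<close> attains its maximum over \<open>[0,t]\<close>
  at \<open>t\<close>, then integration by parts gives
  \<open>\<partial>\<^sub>t\<^sup>\<alpha> u(t) \<ge> t\<^sup>-\<^sup>\<alpha> (u(t) - u(0)) / \<Gamma>(1 - \<alpha>)\<close>, hence \<open>P(\<partial>\<^sub>t) u(t) \<ge> 0\<close>, with strict inequality
  if \<open>u(t) > u(0)\<close>. Lumping makes the mass matrix positive diagonal, so \<open>S\<close> and \<open>H\<close> are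
  diagonally dominant simultaneously. If \<open>H\<close> is diagonally dominant and \<open>|U\<^sub>i(t)|\<close> is maximal over
  all components and all times up to \<open>t\<close>, then \<open>(H U(t))\<^sub>i\<close> does not have the sign opposite to
  \<open>U\<^sub>i(t)\<close>, so \<open>P(\<partial>\<^sub>t) U + H U = 0\<close> excludes \<open>|U\<^sub>i(t)| > max |V\<^sub>j|\<close>. Conversely, if row \<open>i\<close> violates
  dominance, take \<open>V\<^sub>i = 1\<close> and \<open>V\<^sub>j = -sgn h\<^sub>i\<^sub>j\<close>: then \<open>P(\<partial>\<^sub>t) U\<^sub>i = -(H U)\<^sub>i > 0\<close> for small times,
  so \<open>U\<^sub>i\<close> rises above \<open>1 = max |V\<^sub>j|\<close>.\<close>

section \<open>Maximum principle for Caputo derivatives and for \<open>frac_op\<close>\<close>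

text \<open>The derivative of \<open>(t - s) powr (- \<alpha>) * (u s - u t)\<close> is the
  integrand plus a term that is nonpositive because \<open>u s \<le> u t\<close>. Integration over
  \<open>{0..t}\<close> leaves only the boundary value at \<open>0\<close>.\<close>

lemma integral_kernel_derivative_ge_at_max:
  fixes u u' :: "real \<Rightarrow> real"
  assumes "0 < t" "0 < \<alpha>" "\<alpha> < 1"
    and cont: "continuous_on {0..t} u"
    and der: "\<And>s. 0 < s \<Longrightarrow> s < t \<Longrightarrow> (u has_real_derivative u' s) (at s)"
    and dert: "u differentiable (at t)"
    and int: "set_integrable lborel {0<..<t} (\<lambda>s. (t - s) powr (- \<alpha>) * u' s)"
    and max: "\<And>s. 0 \<le> s \<Longrightarrow> s \<le> t \<Longrightarrow> u s \<le> u t"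
  shows "t powr (- \<alpha>) * (u t - u 0) \<le> (LINT s:{0<..<t}|lborel. (t - s) powr (- \<alpha>) * u' s)"
proof -
  \<comment> \<open>Subtracting the constant \<open>u t\<close> does not affect \<open>u'\<close>
    and compensates the singular kernel: \<open>F\<close> tends to \<open>0\<close> at
    \<open>s = t\<close>.\<close>
  define F where "F s = (t - s) powr (- \<alpha>) * (u s - u t)" for s
  define F' where "F' s = (t - s) powr (- \<alpha>) * u' s + \<alpha> * (t - s) powr (- \<alpha> - 1) * (u s - u t)"
    for s
  have contF: "continuous_on {0..t} F"
  proof (unfold continuous_on_def, intro ballI)
    fix x assume x: "x \<in> {0..t}"
    show "(F \<longlongrightarrow> F x) (at x within {0..t})"
    proof (cases "x = t")
      case False
      with x have "x < t" by simp
      moreover have "(u \<longlongrightarrow> u x) (at x within {0..t})"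
        using cont x by (simp add: continuous_on_def)
      ultimately show ?thesis
        unfolding F_def by (intro tendsto_intros) auto
    next
      case True
      \<comment> \<open>Near \<open>t\<close>, \<open>F s\<close> is
        \<open>- ((t - s) powr (1 - \<alpha>))\<close> times a difference quotient. The power tends
        to \<open>0\<close> since \<alpha> < 1, and the quotient converges to
        \<open>D\<close>.\<close>
      obtain D where "(u has_real_derivative D) (at t)"
        using dert by (auto simp: real_differentiable_def)
      then have "(u has_real_derivative D) (at t within {0..t})"
        by (rule has_field_derivative_at_within)
      then have "((\<lambda>s. (u s - u t) / (s - t)) \<longlongrightarrow> D) (at t within {0..t})"
        by (simp add: has_field_derivative_iff)
      moreover have "((\<lambda>s. (t - s) powr (1 - \<alpha>)) \<longlongrightarrow> 0) (at t within {0..t})"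
      proof -
        have "((\<lambda>s. (t - s) powr (1 - \<alpha>)) \<longlongrightarrow> (t - t) powr (1 - \<alpha>)) (at t within {0..t})"
          using \<open>\<alpha> < 1\<close>
          by (intro tendsto_powr' tendsto_intros)
            (auto simp: eventually_at intro!: exI[of _ 1])
        then show ?thesis by simp
      qed
      ultimately have "((\<lambda>s. - ((t - s) powr (1 - \<alpha>) * ((u s - u t) / (s - t)))) \<longlongrightarrow> - (0 * D))
          (at t within {0..t})"
        by (intro tendsto_intros)
      moreover have "- ((t - s) powr (1 - \<alpha>) * ((u s - u t) / (s - t))) = F s"
        if "s \<noteq> t" "s \<in> {0..t}" for s
      proof -
        have "(t - s) powr (1 - \<alpha>) = (t - s) * (t - s) powr (- \<alpha>)"
          using powr_add[of "t - s" 1 "- \<alpha>"] that by simp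
        then show ?thesis using that by (simp add: F_def divide_simps) (simp add: algebra_simps)
      qed
      then have "\<forall>\<^sub>F s in at t within {0..t}.
          - ((t - s) powr (1 - \<alpha>) * ((u s - u t) / (s - t))) = F s"
        unfolding eventually_at_filter by (intro always_eventually) blast
      ultimately have "(F \<longlongrightarrow> - (0 * D)) (at t within {0..t})"
        by (rule Lim_transform_eventually)
      then have "(F \<longlongrightarrow> 0) (at t within {0..t})"
        by simp
      then show ?thesis by (simp add: True F_def)
    qed
  qed
  have "(F has_vector_derivative F' s) (at s)" if "s \<in> {0<..<t}" for s
  proof -
    have "(F has_real_derivative F' s) (at s)"
      unfolding F_def F'_def
      by (rule derivative_eq_intros der refl | use that in simp)+
    then show ?thesis by (simp add: has_real_derivative_iff_has_vector_derivative)
  qed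
  \<comment> \<open>The fundamental theorem for the gauge integral supplies the integrability of
    \<open>F'\<close>, so the more singular term needs no estimate of its own. At \<open>0\<close>
    only continuity of \<open>F\<close> enters, which allows \<open>u'\<close> to blow up
    there.\<close>
  then have "(F' has_integral (F t - F 0)) {0..t}"
    using \<open>0 < t\<close> contF by (intro fundamental_theorem_of_calculus_interior) auto
  then have "(F' has_integral (F t - F 0)) {0<..<t}"
    by (simp add: has_integral_Icc_iff_Ioo)
  moreover have "((\<lambda>s. (t - s) powr (- \<alpha>) * u' s) has_integral
      (LINT s:{0<..<t}|lborel. (t - s) powr (- \<alpha>) * u' s)) {0<..<t}"
    using set_borel_integral_eq_integral[OF int] by (simp add: has_integral_integral)
  moreover have "F' s \<le> (t - s) powr (- \<alpha>) * u' s" if "s \<in> {0<..<t}" for s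
    using that max[of s] \<open>0 < \<alpha>\<close> by (auto simp: F'_def intro!: mult_nonneg_nonpos)
  ultimately have "F t - F 0 \<le> (LINT s:{0<..<t}|lborel. (t - s) powr (- \<alpha>) * u' s)"
    by (rule has_integral_le)
  then show ?thesis by (simp add: F_def algebra_simps)
qed

text \<open>Pairing with a fixed vector \<open>a\<close> commutes with the derivative and the
  Lebesgue integral, which reduces the claim to the scalar function \<open>a \<bullet> U\<close>.
  Later \<open>a\<close> is a signed multiple of a coordinate vector.\<close>

lemma caputo_derivative_ge_at_max:
  fixes U :: "real \<Rightarrow> 'a::euclidean_space"
  assumes "0 < t" "0 < \<alpha>" "\<alpha> < 1"
    and cont: "continuous_on {0..t} U"
    and der: "\<And>s. 0 < s \<Longrightarrow> s \<le> t \<Longrightarrow> U differentiable (at s)"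
    and int: "has_caputo_derivative \<alpha> U t"
    and max: "\<And>s. 0 \<le> s \<Longrightarrow> s \<le> t \<Longrightarrow> a \<bullet> U s \<le> a \<bullet> U t"
  shows "t powr (- \<alpha>) * (a \<bullet> U t - a \<bullet> U 0) / Gamma (1 - \<alpha>) \<le> a \<bullet> caputo_derivative \<alpha> U t"
proof -
  define u' where "u' s = a \<bullet> vector_derivative U (at s)" for s
  let ?f = "\<lambda>s. indicator {0<..<t} s *\<^sub>R (t - s) powr (- \<alpha>) *\<^sub>R vector_derivative U (at s)"
  have int': "integrable lborel ?f"
    using int by (simp add: has_caputo_derivative_def set_integrable_def)
  then have "integrable lborel (\<lambda>s. a \<bullet> ?f s)"
    by (rule integrable_inner_right)
  then have intu: "set_integrable lborel {0<..<t} (\<lambda>s. (t - s) powr (- \<alpha>) * u' s)"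
    by (simp add: set_integrable_def u'_def mult.assoc)
  have eq: "(LINT s:{0<..<t}|lborel. (t - s) powr (- \<alpha>) * u' s) = a \<bullet> integral\<^sup>L lborel ?f"
    unfolding integral_inner_right[OF int', symmetric]
    by (simp add: set_lebesgue_integral_def u'_def mult.assoc)
  have deru: "((\<lambda>s. a \<bullet> U s) has_real_derivative u' s) (at s)" if "0 < s" "s \<le> t" for s
  proof -
    have "(U has_vector_derivative vector_derivative U (at s)) (at s)"
      using der[OF that] by (simp add: vector_derivative_works)
    then have "((\<lambda>s. a \<bullet> U s) has_vector_derivative u' s) (at s)"
      unfolding u'_def
      by (rule bounded_linear.has_vector_derivative[OF bounded_linear_inner_right])
    then show ?thesis by (simp add: has_real_derivative_iff_has_vector_derivative)
  qed
  have "t powr (- \<alpha>) * (a \<bullet> U t - a \<bullet> U 0) \<le> a \<bullet> integral\<^sup>L lborel ?f"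
    unfolding eq[symmetric]
  proof (rule integral_kernel_derivative_ge_at_max)
    show "(\<lambda>s. a \<bullet> U s) differentiable at t"
      using deru[of t] \<open>0 < t\<close> real_differentiable_def by blast
  qed (use assms deru intu in \<open>auto intro!: continuous_intros\<close>)
  moreover have "0 < Gamma (1 - \<alpha>)"
    using \<open>\<alpha> < 1\<close> by (intro Gamma_real_pos) simp
  ultimately show ?thesis
    by (simp add: caputo_derivative_def set_lebesgue_integral_def divide_right_mono)
qed

text \<open>The bound for each order is integrated against \<nu>. The condition
  \<open>\<not> (AE \<alpha> in \<nu>. False)\<close> says that \<nu> is not the zero measure, so
  strictness survives the integration.\<close>

lemma frac_op_at_max:
  fixes U :: "real \<Rightarrow> 'a::euclidean_space"
  assumes "0 < t"
    and ae: "AE \<alpha> in \<nu>. 0 < \<alpha> \<and> \<alpha> < 1"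
    and cont: "continuous_on {0..t} U"
    and der: "\<And>s. 0 < s \<Longrightarrow> s \<le> t \<Longrightarrow> U differentiable (at s)"
    and def: "frac_op_defined \<nu> U t"
    and max: "\<And>s. 0 \<le> s \<Longrightarrow> s \<le> t \<Longrightarrow> a \<bullet> U s \<le> a \<bullet> U t"
  shows frac_op_nonneg_at_max: "0 \<le> a \<bullet> frac_op \<nu> U t"
    and frac_op_pos_at_max:
      "a \<bullet> U 0 < a \<bullet> U t \<Longrightarrow> \<not> (AE \<alpha> in \<nu>. False) \<Longrightarrow> 0 < a \<bullet> frac_op \<nu> U t"
proof -
  let ?c = "\<lambda>\<alpha>. a \<bullet> caputo_derivative \<alpha> U t"
  have int: "integrable \<nu> (\<lambda>\<alpha>. caputo_derivative \<alpha> U t)"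
    using def by (simp add: frac_op_defined_def)
  then have intc: "integrable \<nu> ?c" by (rule integrable_inner_right)
  have eq: "a \<bullet> frac_op \<nu> U t = integral\<^sup>L \<nu> ?c"
    unfolding frac_op_def by (rule integral_inner_right[OF int, symmetric])
  \<comment> \<open>Positivity of \<open>Gamma (1 - \<alpha>)\<close> is recorded with the bound
    because the signs of the quotients below depend on it.\<close>
  have ge: "AE \<alpha> in \<nu>. 0 < Gamma (1 - \<alpha>) \<and>
      t powr (- \<alpha>) * (a \<bullet> U t - a \<bullet> U 0) / Gamma (1 - \<alpha>) \<le> ?c \<alpha>"
    using ae conjunct1[OF def[unfolded frac_op_defined_def]]
  proof eventually_elim
    case (elim \<alpha>)
    then show ?case
      using caputo_derivative_ge_at_max[OF \<open>0 < t\<close> _ _ cont der _ max]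
      by (auto intro: Gamma_real_pos)
  qed
  have "a \<bullet> U 0 \<le> a \<bullet> U t" using max[of 0] \<open>0 < t\<close> by simp
  then have "AE \<alpha> in \<nu>. 0 \<le> t powr (- \<alpha>) * (a \<bullet> U t - a \<bullet> U 0) / Gamma (1 - \<alpha>)"
    using ge by (auto elim!: eventually_mono)
  with ge have nonneg: "AE \<alpha> in \<nu>. 0 \<le> ?c \<alpha>"
    by eventually_elim linarith
  then show "0 \<le> a \<bullet> frac_op \<nu> U t"
    unfolding eq by (rule integral_nonneg_AE)
  assume gt: "a \<bullet> U 0 < a \<bullet> U t" and nontriv: "\<not> (AE \<alpha> in \<nu>. False)"
  \<comment> \<open>A nonnegative integrand with integral \<open>0\<close> vanishes almost
    everywhere, against its strictly positive lower bound.\<close>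
  have "integral\<^sup>L \<nu> ?c \<noteq> 0"
  proof
    assume "integral\<^sup>L \<nu> ?c = 0"
    then have "AE \<alpha> in \<nu>. ?c \<alpha> = 0"
      using integral_nonneg_eq_0_iff_AE[OF intc nonneg] by simp
    then have "AE \<alpha> in \<nu>. False"
      using ge
    proof eventually_elim
      case (elim \<alpha>)
      moreover have "0 < t powr (- \<alpha>) * (a \<bullet> U t - a \<bullet> U 0) / Gamma (1 - \<alpha>)"
        using elim gt \<open>0 < t\<close> by simp
      ultimately show ?case by linarith
    qed
    with nontriv show False by simp
  qed
  with integral_nonneg_AE[OF nonneg] show "0 < a \<bullet> frac_op \<nu> U t"
    unfolding eq by simp
qed

section \<open>Maximum norm and diagonally dominant matrices\<close>

lemma infnorm_le_iff_cart:
  fixes x :: "real^'n"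
  shows "infnorm x \<le> c \<longleftrightarrow> (\<forall>i. \<bar>x $ i\<bar> \<le> c)"
proof
  assume "infnorm x \<le> c"
  then show "\<forall>i. \<bar>x $ i\<bar> \<le> c"
    using component_le_infnorm_cart order_trans by blast
next
  assume "\<forall>i. \<bar>x $ i\<bar> \<le> c"
  then show "infnorm x \<le> c"
    unfolding infnorm_cart by (intro cSup_least) auto
qed

lemma infnorm_attained_cart:
  fixes x :: "real^'n"
  obtains i where "\<bar>x $ i\<bar> = infnorm x"
proof -
  have "finite (range (\<lambda>i. \<bar>x $ i\<bar>))" by simp
  then have "infnorm x \<in> range (\<lambda>i. \<bar>x $ i\<bar>)"
    unfolding infnorm_cart full_SetCompr_eq[symmetric] Setcompr_eq_image
    by (intro closed_contains_Sup finite_imp_closed bdd_above_finite) auto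
  then show ?thesis using that by auto
qed

text \<open>At a component of maximal modulus each off-diagonal term is at most
  \<open>\<bar>H $ i $ j\<bar> * (x $ i)\<^sup>2\<close> in modulus, so the diagonal term outweighs
  their sum. The factor \<open>x $ i\<close> covers both signs at once.\<close>

lemma diagonally_dominant_mult_nonneg:
  fixes H :: "real^'n^'n" and x :: "real^'n"
  assumes dom: "diagonally_dominant H" and i: "\<bar>x $ i\<bar> = infnorm x"
  shows "0 \<le> x $ i * (H *v x) $ i"
proof -
  have "- (\<Sum>j\<in>UNIV - {i}. H $ i $ j * (x $ i * x $ j))
      \<le> (\<Sum>j\<in>UNIV - {i}. \<bar>H $ i $ j\<bar> * (x $ i)\<^sup>2)"
  proof (subst sum_negf[symmetric], rule sum_mono)
    fix j
    have "- (H $ i $ j * (x $ i * x $ j)) \<le> \<bar>H $ i $ j\<bar> * (\<bar>x $ i\<bar> * \<bar>x $ j\<bar>)"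
      using abs_ge_minus_self[of "H $ i $ j * (x $ i * x $ j)"] by (simp add: abs_mult)
    also have "\<dots> \<le> \<bar>H $ i $ j\<bar> * (\<bar>x $ i\<bar> * \<bar>x $ i\<bar>)"
      unfolding i by (intro mult_left_mono component_le_infnorm_cart) (auto simp: infnorm_pos_le)
    finally show "- (H $ i $ j * (x $ i * x $ j)) \<le> \<bar>H $ i $ j\<bar> * (x $ i)\<^sup>2"
      by (simp add: power2_eq_square)
  qed
  also have "\<dots> \<le> H $ i $ i * (x $ i)\<^sup>2"
    using dom by (auto simp: diagonally_dominant_def sum_distrib_right[symmetric]
        intro!: mult_right_mono)
  finally have "0 \<le> H $ i $ i * (x $ i * x $ i) + (\<Sum>j\<in>UNIV - {i}. H $ i $ j * (x $ i * x $ j))"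
    by (simp add: power2_eq_square)
  also have "\<dots> = (\<Sum>j\<in>UNIV. H $ i $ j * (x $ i * x $ j))"
    by (simp add: sum.remove[of UNIV i])
  also have "\<dots> = x $ i * (H *v x) $ i"
    by (simp add: matrix_vector_mult_def sum_distrib_left mult_ac)
  finally show ?thesis .
qed

section \<open>The two implications for the matrix \<open>H\<close>\<close>

lemma solves_frac_ivp_infnorm_le:
  fixes H :: "real^'n^'n"
  assumes ae: "AE \<alpha> in \<nu>. 0 < \<alpha> \<and> \<alpha> < 1" and nontriv: "\<not> (AE \<alpha> in \<nu>. False)"
    and dom: "diagonally_dominant H" and sol: "solves_frac_ivp \<nu> H V U" and "0 \<le> T"
  shows "infnorm (U T) \<le> infnorm V"
proof (rule ccontr)
  assume contr: "\<not> infnorm (U T) \<le> infnorm V"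
  have cont: "continuous_on {0..} U" and U0: "U 0 = V"
    using sol by (auto simp: solves_frac_ivp_def)
  have "continuous_on {0..T} (\<lambda>t. infnorm (U t))"
    by (intro continuous_on_infnorm continuous_on_subset[OF cont]) auto
  \<comment> \<open>A maximiser over all of \<open>{0..T}\<close> also dominates the times before
    it, so the maximum principle applies on \<open>{0..t}\<close>.\<close>
  then obtain t where t: "t \<in> {0..T}" and tmax: "\<And>s. s \<in> {0..T} \<Longrightarrow> infnorm (U s) \<le> infnorm (U t)"
    using continuous_attains_sup[of "{0..T}" "\<lambda>t. infnorm (U t)"] \<open>0 \<le> T\<close> by auto
  have gt: "infnorm V < infnorm (U t)"
    using contr tmax[of T] \<open>0 \<le> T\<close> by simp
  then have "0 < t" using t U0 by (cases "t = 0") auto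
  obtain i where i: "\<bar>U t $ i\<bar> = infnorm (U t)"
    by (rule infnorm_attained_cart)
  \<comment> \<open>Weighting the coordinate vector by \<open>U t $ i\<close> makes
    \<open>a \<bullet> U t\<close> the square of the maximal modulus, whatever the sign of the
    component.\<close>
  define a where "a = axis i (U t $ i)"
  have a: "a \<bullet> x = U t $ i * x $ i" for x
    by (simp add: a_def inner_axis')
  have pos: "0 < \<bar>U t $ i\<bar>"
    using gt i infnorm_pos_le[of V] by linarith
  \<comment> \<open>Equality holds at \<open>x = U t\<close>, so maximality of the norm at
    \<open>t\<close> becomes maximality of \<open>a \<bullet> U s\<close>.\<close>
  have bound: "a \<bullet> x \<le> \<bar>U t $ i\<bar> * infnorm x" for x
  proof -
    have "a \<bullet> x \<le> \<bar>U t $ i\<bar> * \<bar>x $ i\<bar>"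
      using abs_ge_self[of "a \<bullet> x"] by (simp add: a abs_mult)
    also have "\<dots> \<le> \<bar>U t $ i\<bar> * infnorm x"
      by (intro mult_left_mono component_le_infnorm_cart) simp
    finally show ?thesis .
  qed
  have at: "a \<bullet> U t = \<bar>U t $ i\<bar> * infnorm (U t)"
    by (simp add: a flip: i)
  have eq: "frac_op \<nu> U t + H *v U t = 0" and def: "frac_op_defined \<nu> U t"
    using sol \<open>0 < t\<close> by (auto simp: solves_frac_ivp_def)
  have "0 < a \<bullet> frac_op \<nu> U t"
  proof (rule frac_op_pos_at_max[OF \<open>0 < t\<close> ae _ _ def _ _ nontriv])
    show "continuous_on {0..t} U"
      by (rule continuous_on_subset[OF cont]) auto
    show "U differentiable at s" if "0 < s" for s
      using sol that by (auto simp: solves_frac_ivp_def)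
    show "a \<bullet> U s \<le> a \<bullet> U t" if "0 \<le> s" "s \<le> t" for s
      unfolding at using that t pos
      by (intro order_trans[OF bound] mult_left_mono tmax) auto
    show "a \<bullet> U 0 < a \<bullet> U t"
      unfolding at U0 using gt pos by (intro le_less_trans[OF bound]) simp
  qed
  moreover have "0 \<le> a \<bullet> (H *v U t)"
    unfolding a by (rule diagonally_dominant_mult_nonneg[OF dom i])
  moreover have "a \<bullet> frac_op \<nu> U t + a \<bullet> (H *v U t) = 0"
    unfolding inner_add_right[symmetric] eq by simp
  ultimately show False by linarith
qed

text \<open>A row violating dominance makes \<open>(H *v U t) $ i\<close> negative for small
  \<open>t\<close>. Then component \<open>i\<close> attains no minimum over \<open>{0..r}\<close> at
  \<open>r\<close>, which forces it strictly above its initial value \<open>1\<close>.\<close>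

lemma diagonally_dominant_if_contractive:
  fixes H :: "real^'n^'n"
  assumes ae: "AE \<alpha> in \<nu>. 0 < \<alpha> \<and> \<alpha> < 1"
    and sol: "solution_matrix \<nu> H E"
    and "0 < t0" and contr: "\<And>t. 0 < t \<Longrightarrow> t < t0 \<Longrightarrow> max_norm_contractive (E t)"
  shows "diagonally_dominant H"
  unfolding diagonally_dominant_def
proof (intro allI, rule ccontr)
  fix i assume "\<not> (\<Sum>j\<in>UNIV - {i}. \<bar>H $ i $ j\<bar>) \<le> H $ i $ i"
  \<comment> \<open>These signs give \<open>(H *v V) $ i\<close> the value of the diagonal entry
    minus the sum of the off-diagonal moduli. Where \<open>H $ i $ j = 0\<close>, \<open>sgn\<close>
    gives the entry \<open>0\<close>, which keeps the norm at most \<open>1\<close>.\<close>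
  define V :: "real^'n" where "V = (\<chi> j. if j = i then 1 else - sgn (H $ i $ j))"
  define U where "U t = E t *v V" for t
  have "(H *v V) $ i = (\<Sum>j\<in>UNIV. H $ i $ j * V $ j)"
    by (simp add: matrix_vector_mult_def)
  also have "\<dots> = H $ i $ i * V $ i + (\<Sum>j\<in>UNIV - {i}. H $ i $ j * V $ j)"
    by (simp add: sum.remove[of UNIV i])
  also have "(\<Sum>j\<in>UNIV - {i}. H $ i $ j * V $ j) = - (\<Sum>j\<in>UNIV - {i}. \<bar>H $ i $ j\<bar>)"
    unfolding sum_negf[symmetric] by (intro sum.cong) (auto simp: V_def abs_sgn)
  finally have neg: "(H *v V) $ i < 0"
    using \<open>\<not> _\<close> by (simp add: V_def)
  have normV: "infnorm V \<le> 1"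
    by (simp add: infnorm_le_iff_cart V_def abs_sgn_eq)
  have ivp: "solves_frac_ivp \<nu> H V U"
    using sol by (simp add: solution_matrix_def U_def[abs_def])
  then have cont: "continuous_on {0..} U" and U0: "U 0 = V"
    by (auto simp: solves_frac_ivp_def)
  have "continuous_on {0..} (\<lambda>t. (H *v U t) $ i)"
    unfolding matrix_vector_mult_def by (simp, intro continuous_intros cont)
  then have "((\<lambda>t. (H *v U t) $ i) \<longlongrightarrow> (H *v V) $ i) (at 0 within {0..})"
    unfolding continuous_on_def U0[symmetric] by auto
  then have "\<forall>\<^sub>F t in at 0 within {0..}. (H *v U t) $ i < 0"
    using neg by (rule order_tendstoD)
  then obtain d where d: "0 < d" "\<And>t. 0 < t \<Longrightarrow> t < d \<Longrightarrow> (H *v U t) $ i < 0"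
    by (auto simp: eventually_at)
  \<comment> \<open>Halving puts \<open>T\<close> strictly inside both the interval of contractivity
    and that of the negative sign.\<close>
  define T where "T = min t0 d / 2"
  have T: "0 < T" "T < t0" "T < d"
    using \<open>0 < t0\<close> \<open>0 < d\<close> by (auto simp: T_def min_def)
  have "continuous_on {0..T} (\<lambda>t. U t $ i)"
    by (intro continuous_intros continuous_on_subset[OF cont]) auto
  then obtain t where t: "t \<in> {0..T}" and tmin: "\<And>s. s \<in> {0..T} \<Longrightarrow> U t $ i \<le> U s $ i"
    using continuous_attains_inf[of "{0..T}" "\<lambda>t. U t $ i"] \<open>0 < T\<close> by auto
  \<comment> \<open>At such a minimum \<open>- U s $ i\<close> is maximal, so component
    \<open>i\<close> of \<open>frac_op\<close> is at most \<open>0\<close>, while the equation makes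
    it positive.\<close>
  have not_min: "\<not> (\<forall>s\<in>{0..r}. U r $ i \<le> U s $ i)" if r: "0 < r" "r \<le> T" for r
  proof
    assume min: "\<forall>s\<in>{0..r}. U r $ i \<le> U s $ i"
    have eq: "frac_op \<nu> U r + H *v U r = 0" and def: "frac_op_defined \<nu> U r"
      using ivp \<open>0 < r\<close> by (auto simp: solves_frac_ivp_def)
    have "0 \<le> axis i (-1) \<bullet> frac_op \<nu> U r"
    proof (rule frac_op_nonneg_at_max[OF \<open>0 < r\<close> ae _ _ def])
      show "continuous_on {0..r} U"
        by (rule continuous_on_subset[OF cont]) auto
      show "U differentiable at s" if "0 < s" for s
        using ivp that by (auto simp: solves_frac_ivp_def)
    qed (use min in \<open>auto simp: inner_axis'\<close>)
    moreover have "frac_op \<nu> U r $ i + (H *v U r) $ i = 0"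
      using arg_cong[OF eq, of "\<lambda>x. x $ i"] by simp
    ultimately show False
      using d(2)[of r] r T by (simp add: inner_axis')
  qed
  have "t = 0"
    using not_min[of t] t tmin by force
  \<comment> \<open>The minimum over \<open>{0..T}\<close> lies at \<open>0\<close>. If
    \<open>U T $ i\<close> did not exceed it, \<open>T\<close> would be a minimiser as well.\<close>
  have "U T $ i > 1"
  proof (rule ccontr)
    assume "\<not> U T $ i > 1"
    then have "U T $ i \<le> U 0 $ i" by (simp add: U0 V_def)
    then have "\<forall>s\<in>{0..T}. U T $ i \<le> U s $ i"
      using tmin \<open>t = 0\<close> by force
    with not_min[of T] T show False by simp
  qed
  moreover have "infnorm (U T) \<le> 1"
    using contr[of T] T order_trans[OF _ normV] by (simp add: max_norm_contractive_def U_def)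
  ultimately show False
    by (fastforce simp: infnorm_le_iff_cart dest: spec[of _ i])
qed

section \<open>The two kinds of admissible measures\<close>

text \<open>Almost everywhere means at every index of positive weight. The decreasing exponents lie
  between \<open>\<alpha> m > 0\<close> and \<open>\<alpha> 1 < 1\<close>, and index
  \<open>1\<close> carries mass.\<close>

lemma multi_term_measure_AE:
  assumes "multi_term_measure \<nu>"
  shows "AE \<alpha> in \<nu>. 0 < \<alpha> \<and> \<alpha> < 1" and "\<not> (AE \<alpha> in \<nu>. False)"
proof -
  obtain m :: nat and \<alpha> b :: "nat \<Rightarrow> real" where m: "1 \<le> m" and am: "0 < \<alpha> m"
    and dec: "\<forall>i\<in>{1..<m}. \<alpha> (Suc i) < \<alpha> i" and a1: "\<alpha> 1 < 1"
    and b: "\<forall>i\<in>{1..m}. 0 < b i"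
    and \<nu>: "\<nu> = distr (point_measure {1..m} (\<lambda>i. ennreal (b i))) borel \<alpha>"
    using assms unfolding multi_term_measure_def by blast
  have mono: "\<alpha> j \<le> \<alpha> i" if "i \<le> j" "1 \<le> i" "j \<le> m" for i j
    using that
  proof (induction j rule: dec_induct)
    case (step n)
    then have "\<alpha> (Suc n) < \<alpha> n" using dec by auto
    with step show ?case by simp
  qed simp
  have meas: "\<alpha> \<in> measurable (point_measure {1..m} (\<lambda>i. ennreal (b i))) borel"
    by simp
  have "0 < \<alpha> i \<and> \<alpha> i < 1" if "i \<in> {1..m}" for i
    using mono[of i m] mono[of 1 i] that am a1 by auto
  then show "AE \<alpha> in \<nu>. 0 < \<alpha> \<and> \<alpha> < 1"
    unfolding \<nu> by (subst AE_distr_iff[OF meas]) (auto simp: AE_point_measure)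
  show "\<not> (AE \<alpha> in \<nu>. False)"
    unfolding \<nu> using m b
    by (subst AE_distr_iff[OF meas]) (auto simp: AE_point_measure intro!: bexI[of _ 1])
qed

lemma holder_continuous_on_imp_continuous_on:
  assumes "holder_continuous_on A f"
  shows "continuous_on A f"
proof -
  obtain \<gamma> C where \<gamma>: "0 < \<gamma>" and *: "\<And>x y. x \<in> A \<Longrightarrow> y \<in> A \<Longrightarrow> \<bar>f x - f y\<bar> \<le> C * \<bar>x - y\<bar> powr \<gamma>"
    using assms unfolding holder_continuous_on_def by blast
  show ?thesis
    unfolding continuous_on_def
  proof
    fix x assume "x \<in> A"
    have "((\<lambda>y. C * \<bar>y - x\<bar> powr \<gamma>) \<longlongrightarrow> C * \<bar>x - x\<bar> powr \<gamma>) (at x within A)"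
      using \<gamma> by (intro tendsto_intros tendsto_powr') auto
    then have lim: "((\<lambda>y. C * \<bar>y - x\<bar> powr \<gamma>) \<longlongrightarrow> 0) (at x within A)"
      by simp
    have "\<forall>\<^sub>F y in at x within A. norm (f y - f x) \<le> C * \<bar>y - x\<bar> powr \<gamma>"
      unfolding eventually_at_filter real_norm_def
      by (intro always_eventually allI impI * \<open>x \<in> A\<close>)
    then have "((\<lambda>y. f y - f x) \<longlongrightarrow> 0) (at x within A)"
      using lim by (rule Lim_null_comparison)
    then show "(f \<longlongrightarrow> f x) (at x within A)"
      by (simp add: LIM_zero_iff)
  qed
qed

text \<open>The endpoints \<open>0\<close> and \<open>1\<close> form a Lebesgue null set. The
  measure is nonzero because \<mu> is positive at \<open>0\<close> and, by continuity, on an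
  interval to the right of it.\<close>

lemma distributed_order_measure_AE:
  assumes "distributed_order_measure \<nu>"
  shows "AE \<alpha> in \<nu>. 0 < \<alpha> \<and> \<alpha> < 1" and "\<not> (AE \<alpha> in \<nu>. False)"
proof -
  obtain \<mu> :: "real \<Rightarrow> real" where nonneg: "\<forall>\<alpha>\<in>{0..1}. 0 \<le> \<mu> \<alpha>"
    and hol: "holder_continuous_on {0..1} \<mu>" and pos: "0 < \<mu> 0 * \<mu> 1"
    and \<nu>: "\<nu> = density lborel (\<lambda>\<alpha>. indicator {0..1} \<alpha> * ennreal (\<mu> \<alpha>))"
    using assms unfolding distributed_order_measure_def by blast
  have cont: "continuous_on {0..1} \<mu>"
    using hol by (rule holder_continuous_on_imp_continuous_on)
  \<comment> \<open>Nothing is known about \<mu> outside \<open>{0..1}\<close>, so measurability is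
    shown for the function cut off by the indicator.\<close>
  have "(\<lambda>x. indicator {0..1} x *\<^sub>R \<mu> x) \<in> borel_measurable borel"
    using cont by (intro borel_measurable_continuous_on_indicator) auto
  then have "(\<lambda>x. ennreal (indicator {0..1} x *\<^sub>R \<mu> x)) \<in> borel_measurable borel"
    by measurable
  moreover have "(\<lambda>x. ennreal (indicator {0..1} x *\<^sub>R \<mu> x)) = (\<lambda>x. indicator {0..1} x * ennreal (\<mu> x))"
    by (auto simp: indicator_def)
  ultimately have meas: "(\<lambda>x. indicator {0..1} x * ennreal (\<mu> x)) \<in> borel_measurable lborel"
    by simp
  have "AE x in lborel. x \<noteq> (0::real) \<and> x \<noteq> 1"
    using AE_lborel_singleton[of 0] AE_lborel_singleton[of 1] by eventually_elim simp
  then have "AE x in lborel. 0 < indicator {0..1} x * ennreal (\<mu> x) \<longrightarrow> 0 < x \<and> x < (1::real)"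
    by eventually_elim (auto simp: indicator_def split: if_splits)
  then show "AE \<alpha> in \<nu>. 0 < \<alpha> \<and> \<alpha> < 1"
    unfolding \<nu> by (subst AE_density[OF meas])
  have "0 < \<mu> 0"
    using pos nonneg by (simp add: zero_less_mult_iff)
      (metis atLeastAtMost_iff not_less order_refl zero_le_one)
  moreover have "(\<mu> \<longlongrightarrow> \<mu> 0) (at 0 within {0..1})"
    using cont by (simp add: continuous_on_def)
  ultimately have "\<forall>\<^sub>F x in at 0 within {0..1}. 0 < \<mu> x"
    by (simp add: order_tendstoD)
  then obtain d where d: "0 < d" "\<And>x. 0 < x \<Longrightarrow> x \<le> 1 \<Longrightarrow> x < d \<Longrightarrow> 0 < \<mu> x"
    by (auto simp: eventually_at)
  show "\<not> (AE \<alpha> in \<nu>. False)"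
  proof
    assume "AE \<alpha> in \<nu>. False"
    then have "AE x in lborel. \<not> 0 < indicator {0..1} x * ennreal (\<mu> x)"
      unfolding \<nu> by (subst (asm) AE_density[OF meas]) simp
    then have "AE x in lborel. x \<notin> {0<..<min 1 d}"
    proof eventually_elim
      case (elim x)
      then show ?case using d(2)[of x] by (auto simp: indicator_def)
    qed
    then have "emeasure lborel {0<..<min 1 d} = 0"
      by (subst (asm) AE_iff_measurable[where N = "{0<..<min 1 d}"]) auto
    then show False using \<open>0 < d\<close> by simp
  qed
qed

section \<open>The lumped mass matrix and the passage from \<open>S\<close> to
  \<open>H\<close>\<close>

text \<open>A simplex of full dimension has nonempty interior, and a convex set with nonempty
  interior is not negligible.\<close>

lemma measure_lborel_simplex_pos:
  fixes K :: "'a::euclidean_space set"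
  assumes "int DIM('a) simplex K"
  shows "0 < measure lborel K"
proof -
  have "compact K" "convex K" "aff_dim K = int DIM('a)"
    using assms by (auto simp: compact_simplex convex_simplex aff_dim_simplex)
  moreover have "K \<noteq> {}"
    using assms by auto
  ultimately have "interior K \<noteq> {}"
    by (auto simp: interior_rel_interior_gen rel_interior_eq_empty)
  then have "\<not> negligible K"
    using \<open>convex K\<close> by (simp add: negligible_convex_interior)
  then have "measure lebesgue K \<noteq> 0"
    using \<open>compact K\<close> by (simp add: negligible_iff_measure0 lmeasurable_compact)
  then show ?thesis
    using \<open>compact K\<close> by (simp add: borel_compact zero_less_measure_iff)
qed

text \<open>The quadrature samples only vertices. A vertex in \<Omega> is a node, where at most one
  basis function is nonzero; at any other vertex all of them vanish. On the diagonal a triangle with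
  vertex \<open>P i\<close> contributes a positive amount, the others a nonnegative one.\<close>

lemma lumped_mass_matrix_diagonal:
  assumes tri: "triangulation_of \<T> \<Omega>"
    and bij: "bij_betw P UNIV (interior_nodes \<Omega> \<T>)"
    and nodal: "nodal_basis \<Omega> \<T> P \<phi>"
  shows "i \<noteq> j \<Longrightarrow> lumped_mass_matrix \<T> \<phi> $ i $ j = 0"
    and "0 < lumped_mass_matrix \<T> \<phi> $ i $ i"
proof -
  have fin: "finite \<T>" and simplex: "\<And>K. K \<in> \<T> \<Longrightarrow> 2 simplex K"
    using tri by (auto simp: triangulation_of_def triangulation_def)
  have \<phi>P: "\<phi> i (P j) = (if i = j then 1 else 0)" for i j
    using nodal by (simp add: nodal_basis_def)
  have \<phi>0: "x \<notin> \<Omega> \<Longrightarrow> \<phi> i x = 0" for i x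
    using nodal by (simp add: nodal_basis_def fe_space_def)
  show "lumped_mass_matrix \<T> \<phi> $ i $ j = 0" if "i \<noteq> j"
  proof -
    have "\<phi> j p * \<phi> i p = 0" if K: "K \<in> \<T>" "p \<in> vertices K" for K p
    proof (cases "p \<in> \<Omega>")
      case True
      then have "p \<in> range P"
        using K bij by (auto simp: interior_nodes_def bij_betw_def)
      then show ?thesis using \<open>i \<noteq> j\<close> by (auto simp: \<phi>P)
    qed (simp add: \<phi>0)
    then have "(\<Sum>p\<in>vertices K. \<phi> j p * \<phi> i p) = 0" if "K \<in> \<T>" for K
      using that by (intro sum.neutral) blast
    then show ?thesis
      by (simp add: lumped_mass_matrix_def lumped_product_def)
  qed
  have "P i \<in> interior_nodes \<Omega> \<T>"
    using bij by (auto simp: bij_betw_def)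
  then obtain K where K: "K \<in> \<T>" "P i \<in> vertices K"
    by (auto simp: interior_nodes_def)
  \<comment> \<open>Finiteness rules out the default value \<open>0\<close> of a sum over an
    infinite set.\<close>
  have "finite (vertices K)"
    using simplex[OF K(1)]
    by (auto simp: vertices_def simplex_imp_polyhedron finite_polyhedron_extreme_points)
  then have "0 < (\<Sum>p\<in>vertices K. \<phi> i p * \<phi> i p)"
    using K(2) by (intro sum_pos2[of _ "P i"]) (auto simp: \<phi>P)
  moreover have "0 < measure lborel K"
    using simplex[OF K(1)] by (intro measure_lborel_simplex_pos) simp
  moreover have "0 \<le> (\<Sum>p\<in>vertices L. \<phi> i p * \<phi> i p)" for L
    by (simp add: sum_nonneg)
  ultimately show "0 < lumped_mass_matrix \<T> \<phi> $ i $ i"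
    unfolding lumped_mass_matrix_def lumped_product_def using fin K(1)
    by (auto intro!: sum_pos2[of _ K])
qed

text \<open>Row \<open>i\<close> of \<open>S\<close> is row \<open>i\<close> of the product scaled
  by \<open>M $ i $ i > 0\<close>, and dominance is invariant under positive scaling of
  rows.\<close>

lemma diagonally_dominant_matrix_inv_diagonal_mult:
  fixes M S :: "real^'n^'n"
  assumes diag: "\<And>i j. i \<noteq> j \<Longrightarrow> M $ i $ j = 0" and pos: "\<And>i. 0 < M $ i $ i"
  shows "diagonally_dominant (matrix_inv M ** S) \<longleftrightarrow> diagonally_dominant S"
proof -
  define H where "H = matrix_inv M ** S"
  have "invertible M"
    using pos by (simp add: invertible_det_nz det_diagonal[OF diag] less_imp_neq[symmetric])
  then have "M ** matrix_inv M = mat 1"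
    \<comment> \<open>\<open>matrix_inv\<close> is a choice operator, so its defining property has
      to be drawn from invertibility.\<close>
    unfolding invertible_def matrix_inv_def by (rule someI2_ex) simp
  then have MH: "M ** H = S"
    by (simp add: H_def matrix_mul_assoc)
  have S: "S $ i $ j = M $ i $ i * H $ i $ j" for i j
  proof -
    have "S $ i $ j = (\<Sum>k\<in>UNIV. M $ i $ k * H $ k $ j)"
      unfolding MH[symmetric] by (simp add: matrix_matrix_mult_def)
    also have "\<dots> = (\<Sum>k\<in>UNIV. if k = i then M $ i $ i * H $ i $ j else 0)"
      using diag by (intro sum.cong) auto
    finally show ?thesis by simp
  qed
  have "(\<Sum>j\<in>UNIV - {i}. \<bar>S $ i $ j\<bar>) = M $ i $ i * (\<Sum>j\<in>UNIV - {i}. \<bar>H $ i $ j\<bar>)" for i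
    using pos[of i] by (simp add: S abs_mult sum_distrib_left)
  then have "diagonally_dominant S \<longleftrightarrow> diagonally_dominant H"
    using pos by (simp add: diagonally_dominant_def S)
  then show ?thesis by (simp add: H_def)
qed

theorem theoremB2:
  fixes \<nu> :: "real measure"
    and \<Omega> :: "(real^2) set" and \<T> :: "(real^2) set set"
    and P :: "'n::finite \<Rightarrow> real^2" and \<phi> :: "'n \<Rightarrow> real^2 \<Rightarrow> real"
    and S M H :: "real^'n^'n" and E :: "real \<Rightarrow> real^'n^'n"
  assumes "multi_term_measure \<nu> \<or> distributed_order_measure \<nu>"
    and "polygonal_domain \<Omega>"
    and "triangulation_of \<T> \<Omega>"
    and "bij_betw P UNIV (interior_nodes \<Omega> \<T>)"
    and "nodal_basis \<Omega> \<T> P \<phi>"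
    and "S = stiffness_matrix \<Omega> \<phi>"
    and "M = lumped_mass_matrix \<T> \<phi>"
    and "H = matrix_inv M ** S"
    and "solution_matrix \<nu> H E"
  shows "(diagonally_dominant S \<longrightarrow> (\<forall>t\<ge>0. max_norm_contractive (E t))) \<and>
         ((\<exists>t0>0. \<forall>t\<in>{0<..<t0}. max_norm_contractive (E t)) \<longrightarrow> diagonally_dominant S)"
proof -
  have ae: "AE \<alpha> in \<nu>. 0 < \<alpha> \<and> \<alpha> < 1" and nontriv: "\<not> (AE \<alpha> in \<nu>. False)"
    using assms(1) multi_term_measure_AE distributed_order_measure_AE by blast+
  \<comment> \<open>With this equivalence both implications can be proved for \<open>H\<close>, the
    matrix in the evolution equation.\<close>
  have dom: "diagonally_dominant H \<longleftrightarrow> diagonally_dominant S"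
    unfolding assms(7,8)
    by (intro diagonally_dominant_matrix_inv_diagonal_mult
        lumped_mass_matrix_diagonal[OF assms(3-5)])
  have "max_norm_contractive (E t)" if "diagonally_dominant H" "0 \<le> t" for t
    using solves_frac_ivp_infnorm_le[OF ae nontriv that(1) _ that(2)] assms(9)
    by (auto simp: max_norm_contractive_def solution_matrix_def)
  moreover have "diagonally_dominant H"
    if "0 < t0" "\<forall>t\<in>{0<..<t0}. max_norm_contractive (E t)" for t0
    using diagonally_dominant_if_contractive[OF ae assms(9) that(1)] that(2) by auto
  ultimately show ?thesis
    unfolding dom by blast
qed

end
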